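(* Let $\alpha$ be a reduced operation sequence. (a) Any operation of $\alpha$ whose corresponding operations do not occupy a set of consecutive positions of $\alpha$ is fixed. (b) Any operation of $\alpha$ that corresponds to a fixed operation of $\alpha$ is fixed.
   Context: Operation sequences: $\sigma[a]$ ($a\ge1$) denotes pushing the top $a$ elements of the input stack, as a block with relative order unchanged, onto the top of a working stack; $\tau[b]$ ($b\ge1$) denotes moving the top $b$ elements of the working stack, as a block with relative order unchanged, onto the top of an output stack; $\sigma=\sigma[1]$, $\tau=\tau[1]$. A well-formed operation sequence is a word $\alpha=\alpha_1\cdots\alpha_m$ in these symbols such that in every prefix the total push size is at least the total pop size, with equality for the whole word; its size $n$ is the total push size. Acting on an input stack containing $1,\dots,n$ with $1$ on top, it produces the permutation read from the final output stack top to bottom. Two well-formed sequences are equivalent if they have the same size and produce the same permutation. $\alpha$ is reduced if every consecutive pair $\alpha_i\alpha_{i+1}$ with $\alpha_i$ a push and $\alpha_{i+1}$ a pop equals $\sigma[1]\tau[1]$. The vertices of $\alpha$ are $v_0=(0,0)$ and $v_i=v_{i-1}+(a,a)$ if $\alpha_i=\sigma[a]$, $v_i=v_{i-1}+(b,-b)$ if $\alpha_i=\tau[b]$. The support of a push (resp. pop) is the set of elements it places on (resp. removes from) the working stack when $\alpha$ acts on input $1,\dots,n$. A push and a pop correspond if their supports intersect (the operations corresponding to a push are pops, and vice versa). An operation $\alpha_i$ of a reduced sequence $\alpha$ is fixed if for every reduced sequence $\beta=\beta_1\cdots\beta_{m'}$ equivalent to $\alpha$, with vertices $w_0,\dots,w_{m'}$,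 there is $j$ with $w_{j-1}=v_{i-1}$ and $w_j=v_i$. *)

theory Defs
  imports Main
begin

(* Operations: Push a = sigma[a], Pop b = tau[b]. Sequences are lists, positions 0-indexed. *)
datatype oper = Push nat | Pop nat

fun osize :: "oper \<Rightarrow> nat" where
  "osize (Push a) = a"
| "osize (Pop b) = b"

fun is_push :: "oper \<Rightarrow> bool" where
  "is_push (Push a) = True"
| "is_push (Pop b) = False"

definition push_total :: "oper list \<Rightarrow> nat" where
  "push_total xs = sum_list (map (\<lambda>op. case op of Push a \<Rightarrow> a | Pop b \<Rightarrow> 0) xs)"

definition pop_total :: "oper list \<Rightarrow> nat" where
  "pop_total xs = sum_list (map (\<lambda>op. case op of Push a \<Rightarrow> 0 | Pop b \<Rightarrow> b) xs)"

definition well_formed :: "oper list \<Rightarrow> bool" where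
  "well_formed \<alpha> \<longleftrightarrow> (\<forall>op\<in>set \<alpha>. 1 \<le> osize op)
     \<and> (\<forall>k\<le>length \<alpha>. pop_total (take k \<alpha>) \<le> push_total (take k \<alpha>))
     \<and> push_total \<alpha> = pop_total \<alpha>"

definition seq_size :: "oper list \<Rightarrow> nat" where
  "seq_size \<alpha> = push_total \<alpha>"

(* state = (input stack, working stack, output stack), each a list with head = top *)
fun step :: "nat list \<times> nat list \<times> nat list \<Rightarrow> oper \<Rightarrow> nat list \<times> nat list \<times> nat list" where
  "step (inp, w, out) (Push a) = (drop a inp, take a inp @ w, out)"
| "step (inp, w, out) (Pop b) = (inp, drop b w, take b w @ out)"

definition state :: "oper list \<Rightarrow> nat \<Rightarrow> nat list \<times> nat list \<times> nat list" where
  "state \<alpha> k = foldl step ([1..<seq_size \<alpha> + 1], [], []) (take k \<alpha>)"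

(* produced permutation: final output stack read top to bottom *)
definition result :: "oper list \<Rightarrow> nat list" where
  "result \<alpha> = snd (snd (state \<alpha> (length \<alpha>)))"

definition equivalent :: "oper list \<Rightarrow> oper list \<Rightarrow> bool" where
  "equivalent \<alpha> \<beta> \<longleftrightarrow> well_formed \<alpha> \<and> well_formed \<beta>
     \<and> seq_size \<alpha> = seq_size \<beta> \<and> result \<alpha> = result \<beta>"

definition reduced :: "oper list \<Rightarrow> bool" where
  "reduced \<alpha> \<longleftrightarrow> (\<forall>i. Suc i < length \<alpha> \<longrightarrow> is_push (\<alpha> ! i) \<longrightarrow> \<not> is_push (\<alpha> ! Suc i)
      \<longrightarrow> \<alpha> ! i = Push 1 \<and> \<alpha> ! Suc i = Pop 1)"

(* vertex v_k (k = 0..length): sum of (a,a) for pushes and (b,-b) for pops among first k ops *)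
definition vertex :: "oper list \<Rightarrow> nat \<Rightarrow> int \<times> int" where
  "vertex \<alpha> k = (int (push_total (take k \<alpha>)) + int (pop_total (take k \<alpha>)),
                   int (push_total (take k \<alpha>)) - int (pop_total (take k \<alpha>)))"

definition support :: "oper list \<Rightarrow> nat \<Rightarrow> nat set" where
  "support \<alpha> i = (case \<alpha> ! i of
       Push a \<Rightarrow> set (take a (fst (state \<alpha> i)))
     | Pop b \<Rightarrow> set (take b (fst (snd (state \<alpha> i)))))"

definition corresponds :: "oper list \<Rightarrow> nat \<Rightarrow> nat \<Rightarrow> bool" where
  "corresponds \<alpha> i j \<longleftrightarrow> i < length \<alpha> \<and> j < length \<alpha>
     \<and> is_push (\<alpha> ! i) \<noteq> is_push (\<alpha> ! j) \<and> support \<alpha> i \<inter> support \<alpha> j \<noteq> {}"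

definition fixed_op :: "oper list \<Rightarrow> nat \<Rightarrow> bool" where
  "fixed_op \<alpha> i \<longleftrightarrow> i < length \<alpha> \<and>
     (\<forall>\<beta>. reduced \<beta> \<and> equivalent \<alpha> \<beta> \<longrightarrow>
        (\<exists>j < length \<beta>. vertex \<beta> j = vertex \<alpha> i \<and> vertex \<beta> (Suc j) = vertex \<alpha> (Suc i)))"

definition consecutive :: "nat set \<Rightarrow> bool" where
  "consecutive S \<longleftrightarrow> (\<forall>j k m. j \<in> S \<longrightarrow> k \<in> S \<longrightarrow> j \<le> m \<longrightarrow> m \<le> k \<longrightarrow> m \<in> S)"

end

theory Submission
  imports Defs
begin

text \<open>
  Record a sequence by the times \<open>s e < t e\<close> at which each element \<open>e\<close> is pushed and popped.
  Whether two elements \<open>x < y\<close> form an inversion of the produced permutation is decided by their times: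
  they form a noninversion iff they share both push and pop, or share neither while \<open>y\<close> sits
  above \<open>x\<close> on the working stack. In a reduced sequence the elements moved at push-pop turns (peaks)
  are exactly those \<open>z\<close> that form no noninversion with a later input element, so all equivalent reduced
  sequences have the same peaks. The peak following a push of several elements forms a
  noninversion with each of them, so in every equivalent sequence these elements are on the working stack
  together. If their pops are interrupted, a peak \<open>z\<close> lies between two of the pops and forbids a common
  pop in any equivalent sequence, so the common push survives; likewise a fixed pop block determines
  the push blocks it meets. Finally, a push block shared by two equivalent reduced sequences occurs at
  the same vertex. The statements for pops follow by time reversal.
\<close>

section \<open>Schedules\<close>

text \<open>
  \<open>p\<close> and \<open>q\<close> are the positions in the input and output stacks, counted from the top. Times
  are integers so that time reversal is \<open>(p, q, s, t) \<mapsto> (q, p, -t, -s)\<close>.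
\<close>

locale schedule =
  fixes E :: "'a set" and p q :: "'a \<Rightarrow> nat" and s t :: "'a \<Rightarrow> int"
  assumes inj_p: "inj_on p E"
    and inj_q: "inj_on q E"
    and push_before_pop: "x \<in> E \<Longrightarrow> s x < t x"
    and noninversion: "\<lbrakk>x \<in> E; y \<in> E; p x < p y; q x < q y\<rbrakk> \<Longrightarrow>
      s x = s y \<and> t x = t y \<or> s x < s y \<and> t y < t x"
    and inversion: "\<lbrakk>x \<in> E; y \<in> E; p x < p y; q y < q x\<rbrakk> \<Longrightarrow>
      s x = s y \<and> t x < t y \<or> s x < s y \<and> t x = t y \<or> t x < s y"
    and push_neq_pop: "\<lbrakk>x \<in> E; y \<in> E\<rbrakk> \<Longrightarrow> s x \<noteq> t y"
    and no_idle: "\<lbrakk>x \<in> E; s x \<le> k; k \<le> t x\<rbrakk> \<Longrightarrow> k \<in> s ` E \<union> t ` E"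
    and turn: "\<lbrakk>x \<in> E; y \<in> E; t y = s x + 1\<rbrakk> \<Longrightarrow> x = y"
begin

section \<open>Order, time reversal and peaks within one schedule\<close>

lemma p_neq: "\<lbrakk>x \<in> E; y \<in> E; x \<noteq> y\<rbrakk> \<Longrightarrow> p x < p y \<or> p y < p x"
  using inj_p by (meson inj_onD linorder_neqE_nat)

lemma q_neq: "\<lbrakk>x \<in> E; y \<in> E; x \<noteq> y\<rbrakk> \<Longrightarrow> q x < q y \<or> q y < q x"
  using inj_q by (meson inj_onD linorder_neqE_nat)

lemma push_mono:
  assumes "x \<in> E" "y \<in> E" "p x < p y"
  shows "s x \<le> s y"
proof -
  have "q x < q y \<or> q y < q x" using q_neq[of x y] assms by auto
  then show ?thesis
    using noninversion[of x y] inversion[of x y] push_before_pop[of x] assms by force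
qed

lemma push_less_imp: "\<lbrakk>x \<in> E; y \<in> E; s x < s y\<rbrakk> \<Longrightarrow> p x < p y"
  using push_mono[of y x] p_neq[of x y] by force

text \<open>Read backwards, a pop is a push and the output stack is the input stack. The locale
  assumptions are symmetric under this exchange, so each fact about pushes yields one about
  pops.\<close>

lemma dual: "schedule E q p (\<lambda>x. - t x) (\<lambda>x. - s x)"
proof
  show "inj_on q E" "inj_on p E" by (fact inj_q inj_p)+
next
  fix x assume "x \<in> E" then show "- t x < - s x" using push_before_pop by simp
next
  fix x y assume "x \<in> E" "y \<in> E" "q x < q y" "p x < p y"
  then show "- t x = - t y \<and> - s x = - s y \<or> - t x < - t y \<and> - s y < - s x"
    using noninversion[of x y] by auto
next
  fix x y assume "x \<in> E" "y \<in> E" "q x < q y" "p y < p x"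
  then show "- t x = - t y \<and> - s x < - s y \<or> - t x < - t y \<and> - s x = - s y \<or> - s x < - t y"
    using inversion[of y x] by auto
next
  fix x y assume "x \<in> E" "y \<in> E"
  then show "- t x \<noteq> - s y" using push_neq_pop[of y x] by auto
next
  fix x k assume "x \<in> E" "- t x \<le> k" "k \<le> - s x"
  then have "- k \<in> s ` E \<union> t ` E" using no_idle[of x "- k"] by auto
  then show "k \<in> (\<lambda>x. - t x) ` E \<union> (\<lambda>x. - s x) ` E" by force
next
  fix x y assume "x \<in> E" "y \<in> E" "- s y = - t x + 1"
  then show "x = y" using turn[of y x] by auto
qed

text \<open>The witness is the element moved at the first push-pop turn after \<open>x\<close> is pushed.\<close>

lemma next_peak:
  assumes x: "x \<in> E"
  obtains w where "w \<in> E" "t w = s w + 1" "s x \<le> s w"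
    "\<forall>y\<in>E. s y = s x \<longrightarrow> y = w \<or> s y < s w \<and> t w < t y"
proof -
  \<comment> \<open>The integers have no least-element principle, so the first pop after
    \<open>s x\<close> is found through a natural offset; \<open>k\<close> is the time just before
    that pop.\<close>
  define P where "P n \<longleftrightarrow> s x + int (Suc n) \<in> t ` E" for n
  have "P (nat (t x - s x - 1))" using push_before_pop[OF x] x by (simp add: P_def)
  then have P: "P (Least P)" and least: "\<And>n. P n \<Longrightarrow> Least P \<le> n"
    by (auto intro: LeastI Least_le)
  define k where "k = s x + int (Least P)"
  have sk: "s x \<le> k" by (simp add: k_def)
  obtain w where w: "w \<in> E" "t w = k + 1" using P by (auto simp: P_def k_def)
  have ge: "k < t y" if "y \<in> E" "s x < t y" for y
  proof -
    have "P (nat (t y - s x - 1))" using that by (simp add: P_def)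
    then show ?thesis using least that by (fastforce simp: k_def)
  qed
  \<comment> \<open>Time \<open>k\<close> lies between push and pop of \<open>x\<close>, so some
    operation occurs then. The first pop after \<open>s x\<close> is at \<open>k + 1\<close>, so it
    is a push, and \<open>turn\<close> identifies its element with \<open>w\<close>.\<close>
  have "k \<in> s ` E \<union> t ` E" using no_idle[OF x sk] ge[OF x] push_before_pop[OF x] by auto
  moreover have "k \<notin> t ` E" using ge push_neq_pop[OF x] sk by fastforce
  ultimately obtain v where v: "v \<in> E" "s v = k" by blast
  then have sw: "s w = k" using turn[of v w] w by auto
  show thesis
  proof
    show "w \<in> E" "t w = s w + 1" "s x \<le> s w" using w sw sk by auto
    show "\<forall>y\<in>E. s y = s x \<longrightarrow> y = w \<or> s y < s w \<and> t w < t y"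
    proof (intro ballI impI)
      fix y assume y: "y \<in> E" "s y = s x"
      have 1: "k < t y" using ge[of y] push_before_pop[of y] y by auto
      show "y = w \<or> s y < s w \<and> t w < t y"
      proof (cases "y = w")
        case False
        have "t y \<noteq> k + 1" using turn[of w y] False w y sw by auto
        moreover have "s y \<noteq> k" using turn[of y w] False w y by auto
        ultimately show ?thesis using 1 sk sw w y by auto
      qed simp
    qed
  qed
qed

text \<open>A later input element forming a noninversion with a peak \<open>z\<close> would share
  its push, against \<open>turn\<close>, or be pushed and popped strictly between \<open>s z\<close>
  and \<open>s z + 1\<close>. If \<open>z\<close> is not a peak, the next peak comes and goes during
  the stay of \<open>z\<close>, which makes a noninversion.\<close>

lemma peak_iff:
  assumes z: "z \<in> E"
  shows "t z = s z + 1 \<longleftrightarrow> (\<forall>u\<in>E. p z < p u \<longrightarrow> q u \<le> q z)"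
proof
  assume peak: "t z = s z + 1"
  show "\<forall>u\<in>E. p z < p u \<longrightarrow> q u \<le> q z"
  proof (intro ballI impI leI notI)
    fix u assume u: "u \<in> E" "p z < p u" "q z < q u"
    have "s u \<noteq> s z" using turn[of u z] u z peak by auto
    then show False using noninversion[OF z u] push_before_pop[of u] u peak by auto
  qed
next
  assume max: "\<forall>u\<in>E. p z < p u \<longrightarrow> q u \<le> q z"
  obtain w where w: "w \<in> E" "t w = s w + 1" "s z \<le> s w"
    "\<forall>y\<in>E. s y = s z \<longrightarrow> y = w \<or> s y < s w \<and> t w < t y"
    by (rule next_peak[OF z])
  have False if "s z < s w" "t w < t z"
  proof -
    have pw: "p z < p w" using push_less_imp z w that by auto
    then have "q w < q z" using max q_neq[of w z] w z by fastforce
    then show False using inversion[of z w] w z that pw by auto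
  qed
  then show "t z = s z + 1" using w z by blast
qed

lemma gap_has_peak:
  assumes x: "x \<in> E" "y \<in> E" "s x = s y" and m: "t x < m" "m < t y"
    and not_popped: "\<forall>e\<in>E. s e = s x \<longrightarrow> t e \<noteq> m"
  obtains z where "z \<in> E" "t z = s z + 1" "t x < t z" "t z < t y"
proof -
  have sx: "s x < t x" using push_before_pop[of x] x by auto
  note result = that
  \<comment> \<open>A push between the two pops suffices: its element lies above \<open>y\<close>,
    so it leaves no later than \<open>y\<close>, and the peak following that push precedes
    \<open>t y\<close>.\<close>
  have push: thesis if e: "e \<in> E" "t x < s e" "s e < t y" for e
  proof -
    have sye: "s y < s e" using sx x e by auto
    then have pye: "p y < p e" using push_less_imp x e by auto
    have te: "t e \<le> t y"
      using noninversion[of y e] inversion[of y e] q_neq[of y e] e x pye sye by fastforce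
    obtain w where w: "w \<in> E" "t w = s w + 1" "s e \<le> s w"
      "\<forall>y\<in>E. s y = s e \<longrightarrow> y = w \<or> s y < s w \<and> t w < t y"
      by (rule next_peak[OF e(1)])
    have "t w \<le> t e" using w(4)[rule_format, of e] e by auto
    moreover have "t w \<noteq> t y" using turn[of w y] w(1-3) x sye by auto
    ultimately show thesis using result[of w] w(1-3) te e by auto
  qed
  have "m \<in> s ` E \<union> t ` E" using no_idle[of y m] x m sx by auto
  then consider e where "e \<in> E" "s e = m" | e where "e \<in> E" "t e = m" by auto
  then show thesis
  proof cases
    case 1 then show thesis using push m by auto
  next
    case e: 2
    then have ne: "s e \<noteq> s x" using not_popped by auto
    \<comment> \<open>An element pushed before the block lies below \<open>y\<close> and cannot
      leave between \<open>s y\<close> and \<open>t y\<close>.\<close>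
    have "\<not> s e < s y"
    proof
      assume l: "s e < s y"
      then have "p e < p y" using push_less_imp x e by auto
      then show False
        using noninversion[of e y] inversion[of e y] q_neq[of e y] e x l m sx by fastforce
    qed
    then have l: "s x < s e" using ne x by auto
    then have "p x < p e" using push_less_imp x e by auto
    \<comment> \<open>Pushed after the block yet popped after \<open>x\<close>, the element
      \<open>e\<close> can only have been pushed once \<open>x\<close> was gone.\<close>
    then have "t x < s e"
      using noninversion[of x e] inversion[of x e] q_neq[of x e] e x l m by fastforce
    then show thesis using push[of e] push_before_pop[of e] e m by auto
  qed
qed

end

section \<open>Two schedules of the same permutation\<close>

locale schedule_pair = A: schedule E p q s t + B: schedule E p q s' t'
  for E :: "'a set" and p q s t s' t'
begin

lemma swap: "schedule_pair E p q s' t' s t"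
  by unfold_locales

lemma dual_pair: "schedule_pair E q p (\<lambda>x. - t x) (\<lambda>x. - s x) (\<lambda>x. - t' x) (\<lambda>x. - s' x)"
  by (intro schedule_pair.intro A.dual B.dual)

lemma peak_transfer: "\<lbrakk>z \<in> E; t z = s z + 1\<rbrakk> \<Longrightarrow> t' z = s' z + 1"
  using A.peak_iff B.peak_iff by blast

text \<open>The peak following the common push of \<open>x\<close> and \<open>y\<close> forms a noninversion with \<open>x\<close>,
  which keeps \<open>x\<close> on the working stack of the other schedule until \<open>y\<close> has been pushed.\<close>

lemma coexist_transfer:
  assumes x: "x \<in> E" "y \<in> E" "s x = s y" "x \<noteq> y"
  shows "s' y < t' x"
proof -
  obtain w where w: "w \<in> E" "t w = s w + 1" "s x \<le> s w"
    "\<forall>y\<in>E. s y = s x \<longrightarrow> y = w \<or> s y < s w \<and> t w < t y"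
    by (rule A.next_peak[OF x(1)])
  have "w \<noteq> x" "w \<noteq> y" using A.turn[of x w] A.turn[of y w] x w by auto
  then have l: "s x < s w" "t w < t x" "s y < s w" using w(4)[rule_format, of x] w(4)[rule_format, of y] x by auto
  then have pw: "p x < p w" "p y < p w" using A.push_less_imp x w by auto
  then have "q x < q w"
    using A.inversion[of x w] A.q_neq[of x w] x w l by fastforce
  then have "s' w < t' x"
    using B.noninversion[of x w] B.push_before_pop[of w] x w pw by fastforce
  then show ?thesis using B.push_mono[of y w] x w pw by auto
qed

text \<open>A common push with different pops is an inversion. In the other schedule an inversion
  has a common push, a common pop or disjoint stays; the second is excluded by assumption, the third
  by \<open>coexist_transfer\<close>.\<close>

lemma same_push_transfer:
  assumes x: "x \<in> E" "y \<in> E" "s x = s y" and ne: "t x \<noteq> t y" "t' x \<noteq> t' y"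
  shows "s' x = s' y"
proof -
  have *: "s' x = s' y" if "x \<in> E" "y \<in> E" "s x = s y" "t x \<noteq> t y" "t' x \<noteq> t' y" "p x < p y" for x y
  proof -
    have "q y < q x"
      using A.noninversion[of x y] A.q_neq[of x y] that by auto
    then show ?thesis using B.inversion[of x y] coexist_transfer[of x y] that by fastforce
  qed
  show ?thesis using *[of x y] *[of y x] A.p_neq[of x y] assms by fastforce
qed

text \<open>If the pops differ, they differ in both schedules and \<open>same_push_transfer\<close>
  applies. If they agree, \<open>x\<close> and \<open>y\<close> share push and pop, hence form a
  noninversion, and a noninversion with a common pop has a common push.\<close>

lemma push_block_sub:
  assumes y: "y \<in> E" and blk: "\<forall>e\<in>E. t e = t y \<longleftrightarrow> t' e = t' y"
    and x: "x \<in> E" "s x = s y"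
  shows "s' x = s' y"
proof (cases "t x = t y")
  case False
  then show ?thesis using same_push_transfer[of x y] blk x y by auto
next
  case True
  then have "t' x = t' y" using blk x by auto
  have *: "s' x = s' y" if "x \<in> E" "y \<in> E" "s x = s y" "t x = t y" "t' x = t' y" "p x < p y" for x y
  proof -
    have "q x < q y"
      using A.inversion[of x y] A.q_neq[of x y] A.push_before_pop[of x] that by fastforce
    then show ?thesis using B.noninversion[of x y] that by auto
  qed
  show ?thesis using *[of x y] *[of y x] A.p_neq[of x y] x y True \<open>t' x = t' y\<close> by fastforce
qed

text \<open>The output order fixes the order of pops weakly. Since \<open>z\<close> is also a peak
  of the other schedule, it is popped alone there, so the order around \<open>z\<close> is strict
  and \<open>x\<close> and \<open>y\<close> have different pops.\<close>

lemma gap_transfer: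
  assumes x: "x \<in> E" "y \<in> E" "s x = s y" and z: "z \<in> E" "t z = s z + 1" "t x < t z" "t z < t y"
  shows "s' x = s' y" "t' x < t' z" "t' z < t' y"
proof -
  have z': "t' z = s' z + 1" using peak_transfer z by auto
  have *: "q f < q e" if "e \<in> E" "f \<in> E" "t e < t f" for e f
    using schedule.push_less_imp[OF A.dual, of f e] that by auto
  have t': "t' f \<ge> t' e" if "e \<in> E" "f \<in> E" "t e < t f" for e f
    using schedule.push_mono[OF B.dual, of f e] *[OF that] that by auto
  have single: "t' e \<noteq> t' z" if "e \<in> E" "e \<noteq> z" for e
    using B.turn[of z e] z z' that by auto
  show "t' x < t' z" using t'[of x z] single[of x] x z by force
  moreover show "t' z < t' y" using t'[of z y] single[of y] x z by force
  ultimately show "s' x = s' y" using same_push_transfer[of x y] x z by auto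
qed

text \<open>Each further element of the block is popped on one side of the peak \<open>z\<close> and
  is compared across \<open>z\<close> with \<open>y\<close> or with \<open>x\<close>.\<close>

lemma gap_push_block_sub:
  assumes x: "x \<in> E" "y \<in> E" "s x = s y" and z: "z \<in> E" "t z = s z + 1" "t x < t z" "t z < t y"
    and e: "e \<in> E" "s e = s x"
  shows "s' e = s' x"
proof -
  have "t e \<noteq> t z" using A.turn[of z e] A.push_before_pop[of x] e z x by auto
  then consider "t e < t z" | "t z < t e" by linarith
  then show ?thesis
  proof cases
    case 1
    then show ?thesis using gap_transfer(1)[of e y z] gap_transfer(1)[of x y z] x z e by auto
  next
    case 2
    then show ?thesis using gap_transfer(1)[of x e z] x z e by auto
  qed
qed

theorem same_push_block_of_gap:
  assumes x: "x \<in> E" "y \<in> E" "s x = s y" and m: "t x < m" "m < t y"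
    and not_popped: "\<forall>e\<in>E. s e = s x \<longrightarrow> t e \<noteq> m"
  shows "\<forall>e\<in>E. s e = s x \<longleftrightarrow> s' e = s' x"
proof -
  interpret S: schedule_pair E p q s' t' s t by (rule swap)
  obtain z where z: "z \<in> E" "t z = s z + 1" "t x < t z" "t z < t y"
    by (rule A.gap_has_peak[OF x m not_popped])
  note tr = gap_transfer[OF x z]
  show ?thesis
    \<comment> \<open>By \<open>gap_transfer\<close>, \<open>x\<close>, \<open>y\<close> and
      \<open>z\<close> satisfy the same hypotheses in the other schedule, so the reverse inclusion
      follows by swapping the two.\<close>
    using gap_push_block_sub[OF x z] S.gap_push_block_sub[of x y z] peak_transfer z x tr by blast
qed

theorem same_push_block_of_same_pop_block:
  assumes y: "y \<in> E" and blk: "\<forall>e\<in>E. t e = t y \<longleftrightarrow> t' e = t' y"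
  shows "\<forall>e\<in>E. s e = s y \<longleftrightarrow> s' e = s' y"
proof -
  interpret S: schedule_pair E p q s' t' s t by (rule swap)
  show ?thesis using push_block_sub[OF assms] S.push_block_sub[OF y] blk by blast
qed

text \<open>Were \<open>e\<close> not yet popped at \<open>s x\<close>, it would form an inversion
  with \<open>x\<close> having a common pop. The peak after the push of \<open>x\<close> is not
  \<open>x\<close>, by \<open>turn\<close>, so it lies within the stay of \<open>e\<close>. This
  noninversion keeps \<open>e\<close> on the working stack of the other schedule until
  \<open>x\<close> has been pushed.\<close>

lemma popped_before_sub:
  assumes x: "x \<in> E" and blk: "\<forall>e\<in>E. s e = s x \<longleftrightarrow> s' e = s' x"
    and e: "e \<in> E" "t' e < s' x"
  shows "t e < s x"
proof (rule ccontr)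
  assume n: "\<not> t e < s x"
  have l: "s' e < s' x" using B.push_before_pop e by force
  then have pe: "p e < p x" using B.push_less_imp e x by auto
  then have se: "s e < s x" using A.push_mono[of e x] blk e x l by force
  have "\<not> q e < q x" using B.noninversion[of e x] B.push_before_pop[of x] pe e x l by fastforce
  then have "q x < q e" using A.q_neq[of e x] e x se by auto
  then have te: "t e = t x" using A.inversion[of e x] pe e x se n by auto
  obtain w where w: "w \<in> E" "t w = s w + 1" "s x \<le> s w"
    "\<forall>y\<in>E. s y = s x \<longrightarrow> y = w \<or> s y < s w \<and> t w < t y"
    by (rule A.next_peak[OF x])
  show False
  proof (cases "x = w")
    case True
    then have "t e = s w + 1" using w(2) te by simp
    then have "w = e" by (rule A.turn[OF w(1) e(1)])
    then show False using True se by simp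
  next
    case False
    then have sw: "s x < s w" "t w < t e" using w(4)[rule_format, OF x] te by auto
    then have pw: "p x < p w" using A.push_less_imp x w(1) sw by auto
    have "q e < q w"
      using A.inversion[of e w] A.q_neq[of e w] e w(1) sw se A.push_before_pop[of w] pw pe by fastforce
    then have "s' w < t' e"
      using B.noninversion[of e w] B.push_before_pop[of w] e w(1) pw pe by fastforce
    moreover have "s' x \<le> s' w" using B.push_mono x w(1) pw by auto
    ultimately show False using e by auto
  qed
qed

text \<open>The elements pushed before the block are those preceding \<open>x\<close> in the input
  and outside the block; those popped before it agree by \<open>popped_before_sub\<close> in both
  directions. These two sets give the vertex where the block starts.\<close>

theorem same_vertex_of_same_push_block:
  assumes x: "x \<in> E" and blk: "\<forall>e\<in>E. s e = s x \<longleftrightarrow> s' e = s' x"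
  shows "\<forall>e\<in>E. (s e < s x \<longleftrightarrow> s' e < s' x) \<and> (t e < s x \<longleftrightarrow> t' e < s' x)"
proof -
  interpret S: schedule_pair E p q s' t' s t by (rule swap)
  have "s e < s x \<longleftrightarrow> p e < p x \<and> s e \<noteq> s x" if "e \<in> E" for e
    using A.push_mono[of e x] A.push_less_imp[of e x] x that by auto
  moreover have "s' e < s' x \<longleftrightarrow> p e < p x \<and> s' e \<noteq> s' x" if "e \<in> E" for e
    using B.push_mono[of e x] B.push_less_imp[of e x] x that by auto
  ultimately show ?thesis
    using popped_before_sub[OF assms] S.popped_before_sub[OF x] blk by blast
qed

end

section \<open>The schedule of an operation sequence\<close>

abbreviation inp :: "oper list \<Rightarrow> nat \<Rightarrow> nat list" where
  "inp \<alpha> k \<equiv> fst (state \<alpha> k)"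

abbreviation work :: "oper list \<Rightarrow> nat \<Rightarrow> nat list" where
  "work \<alpha> k \<equiv> fst (snd (state \<alpha> k))"

abbreviation outp :: "oper list \<Rightarrow> nat \<Rightarrow> nat list" where
  "outp \<alpha> k \<equiv> snd (snd (state \<alpha> k))"

definition elems :: "oper list \<Rightarrow> nat set" where
  "elems \<alpha> = {1..seq_size \<alpha>}"

text \<open>Operation \<open>k\<close> leads from state \<open>k\<close> to state
  \<open>Suc k\<close>, so for an element of a well-formed sequence this is the position of the
  operation pushing it; likewise for \<open>pop_time\<close>.\<close>

definition push_time :: "oper list \<Rightarrow> nat \<Rightarrow> nat" where
  "push_time \<alpha> e = (LEAST k. e \<notin> set (inp \<alpha> (Suc k)))"

definition pop_time :: "oper list \<Rightarrow> nat \<Rightarrow> nat" where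
  "pop_time \<alpha> e = (LEAST k. e \<in> set (outp \<alpha> (Suc k)))"

definition out_pos :: "oper list \<Rightarrow> nat \<Rightarrow> nat" where
  "out_pos \<alpha> e = (LEAST i. result \<alpha> ! i = e)"

text \<open>\<open>a\<close> lies above \<open>b\<close> whenever both are on the working stack.\<close>

definition work_above :: "oper list \<Rightarrow> nat \<Rightarrow> nat \<Rightarrow> bool" where
  "work_above \<alpha> a b \<longleftrightarrow> push_time \<alpha> b < push_time \<alpha> a \<or> push_time \<alpha> a = push_time \<alpha> b \<and> a < b"

definition out_above :: "oper list \<Rightarrow> nat \<Rightarrow> nat \<Rightarrow> bool" where
  "out_above \<alpha> a b \<longleftrightarrow> pop_time \<alpha> b < pop_time \<alpha> a \<or> pop_time \<alpha> a = pop_time \<alpha> b \<and> work_above \<alpha> a b"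

text \<open>Serves \<open>push_time\<close> and \<open>pop_time\<close> alike, because leaving the
  input and reaching the output are irreversible.\<close>

lemma least_threshold:
  fixes P :: "nat \<Rightarrow> bool"
  assumes mono: "\<And>k. k < m \<Longrightarrow> P k \<Longrightarrow> P (Suc k)" and "\<not> P 0" "P m" "k \<le> m"
  shows "P k \<longleftrightarrow> (LEAST k. P (Suc k)) < k"
proof
  assume "P k"
  with \<open>\<not> P 0\<close> obtain j where j: "k = Suc j" by (cases k) auto
  with \<open>P k\<close> show "(LEAST k. P (Suc k)) < k" by (auto intro: Least_le simp: less_Suc_eq_le)
next
  assume l: "(LEAST k. P (Suc k)) < k"
  obtain j where "m = Suc j" using assms by (cases m) auto
  then have "P (Suc (LEAST k. P (Suc k)))" using \<open>P m\<close> by (auto intro: LeastI)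
  with Suc_leI[OF l] \<open>k \<le> m\<close> show "P k"
    by (induction k rule: dec_induct) (auto intro: mono)
qed

section \<open>Totals and stack contents along a sequence\<close>

lemma totals_0 [simp]: "push_total [] = 0" "pop_total [] = 0"
  by (simp_all add: push_total_def pop_total_def)

lemma totals_Suc:
  assumes "k < length \<alpha>"
  shows "push_total (take (Suc k) \<alpha>) =
      push_total (take k \<alpha>) + (if is_push (\<alpha> ! k) then osize (\<alpha> ! k) else 0)"
    and "pop_total (take (Suc k) \<alpha>) =
      pop_total (take k \<alpha>) + (if is_push (\<alpha> ! k) then 0 else osize (\<alpha> ! k))"
  using assms
  by (cases "\<alpha> ! k"; simp add: push_total_def pop_total_def take_Suc_conv_app_nth)+

lemma state_0: "state \<alpha> 0 = ([1..<seq_size \<alpha> + 1], [], [])"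
  by (simp add: state_def)

lemma state_Suc:
  "k < length \<alpha> \<Longrightarrow> state \<alpha> (Suc k) =
    (if is_push (\<alpha> ! k)
     then (drop (osize (\<alpha> ! k)) (inp \<alpha> k), take (osize (\<alpha> ! k)) (inp \<alpha> k) @ work \<alpha> k, outp \<alpha> k)
     else (inp \<alpha> k, drop (osize (\<alpha> ! k)) (work \<alpha> k), take (osize (\<alpha> ! k)) (work \<alpha> k) @ outp \<alpha> k))"
  by (cases "\<alpha> ! k"; cases "state \<alpha> k") (simp_all add: state_def take_Suc_conv_app_nth)

lemma support_eq:
  "support \<alpha> i =
    (if is_push (\<alpha> ! i) then set (take (osize (\<alpha> ! i)) (inp \<alpha> i))
     else set (take (osize (\<alpha> ! i)) (work \<alpha> i)))"
  by (cases "\<alpha> ! i") (simp_all add: support_def)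

context
  fixes \<alpha> :: "oper list"
  assumes wf: "well_formed \<alpha>"
begin

lemma osize_pos: "k < length \<alpha> \<Longrightarrow> 1 \<le> osize (\<alpha> ! k)"
  using wf by (auto simp: well_formed_def)

lemma push_total_le: "k \<le> length \<alpha> \<Longrightarrow> push_total (take k \<alpha>) \<le> seq_size \<alpha>"
  by (induction k rule: inc_induct) (auto simp: seq_size_def totals_Suc)

lemma inp_eq: "k \<le> length \<alpha> \<Longrightarrow> inp \<alpha> k = [Suc (push_total (take k \<alpha>))..<Suc (seq_size \<alpha>)]"
  by (induction k) (auto simp: state_0 state_Suc totals_Suc)

lemma length_work_outp:
  assumes "k \<le> length \<alpha>"
  shows "length (work \<alpha> k) + pop_total (take k \<alpha>) = push_total (take k \<alpha>)
    \<and> length (outp \<alpha> k) = pop_total (take k \<alpha>)"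
  using assms
proof (induction k)
  case 0 show ?case by (simp add: state_0)
next
  case (Suc k)
  \<comment> \<open>With this bound and the next, \<open>take\<close> never falls short: the stack
    an operation takes from holds at least \<open>osize\<close> elements.\<close>
  have "pop_total (take (Suc k) \<alpha>) \<le> push_total (take (Suc k) \<alpha>)"
    using wf Suc.prems by (auto simp: well_formed_def)
  moreover note push_total_le[OF Suc.prems]
  ultimately show ?case using Suc by (auto simp: state_Suc totals_Suc inp_eq)
qed

lemma state_partition:
  assumes "k \<le> length \<alpha>"
  shows "distinct (inp \<alpha> k @ work \<alpha> k @ outp \<alpha> k) \<and>
    set (inp \<alpha> k @ work \<alpha> k @ outp \<alpha> k) = elems \<alpha>"
  using assms
proof (induction k)
  case 0 show ?case by (auto simp: state_0 elems_def)
next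
  case (Suc k)
  let ?b = "osize (\<alpha> ! k)"
  have "distinct (take ?b xs @ drop ?b xs)  = distinct xs" for xs :: "nat list" by simp
  moreover have "set (take ?b xs) \<union> set (drop ?b xs) = set xs" for xs :: "nat list"
    by (metis append_take_drop_id set_append)
  ultimately show ?case using Suc
    by (simp add: state_Suc del: append_take_drop_id) blast
qed

lemma final_state:
  "inp \<alpha> (length \<alpha>) = []" "work \<alpha> (length \<alpha>) = []" "outp \<alpha> (length \<alpha>) = result \<alpha>"
  using length_work_outp[of "length \<alpha>"] wf
  by (auto simp: inp_eq seq_size_def result_def well_formed_def)

lemma set_result: "set (result \<alpha>) = elems \<alpha>"
  and length_result: "length (result \<alpha>) = seq_size \<alpha>"
  using state_partition[of "length \<alpha>"] length_work_outp[of "length \<alpha>"] wf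
  by (auto simp: final_state seq_size_def well_formed_def)

text \<open>The output stack only grows on top, so each intermediate output is a suffix of the
  result. Hence equivalent sequences with equal pop totals have popped the same elements.\<close>

lemma outp_eq:
  assumes "k \<le> length \<alpha>"
  shows "outp \<alpha> k = drop (seq_size \<alpha> - pop_total (take k \<alpha>)) (result \<alpha>)"
proof -
  have "\<exists>xs. result \<alpha> = xs @ outp \<alpha> k" using assms
  proof (induction k rule: inc_induct)
    case base show ?case by (simp add: final_state)
  next
    case (step k) then show ?case by (auto simp: state_Suc split: if_splits)
  qed
  then obtain xs where xs: "result \<alpha> = xs @ outp \<alpha> k" ..
  then have "length xs = seq_size \<alpha> - pop_total (take k \<alpha>)"
    using length_result length_work_outp[OF assms] by simp
  then show ?thesis using xs by simp
qed

section \<open>Push and pop times of the elements\<close>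

lemma push_time_less_iff:
  assumes "e \<in> elems \<alpha>" "k \<le> length \<alpha>"
  shows "push_time \<alpha> e < k \<longleftrightarrow> e \<notin> set (inp \<alpha> k)"
  unfolding push_time_def
  using assms
  by (intro least_threshold[of "length \<alpha>", symmetric])
     (auto simp: state_Suc final_state state_0 elems_def dest: in_set_dropD)

lemma pop_time_less_iff:
  assumes "e \<in> elems \<alpha>" "k \<le> length \<alpha>"
  shows "pop_time \<alpha> e < k \<longleftrightarrow> e \<in> set (outp \<alpha> k)"
  unfolding pop_time_def
  using assms
  by (intro least_threshold[of "length \<alpha>", symmetric])
     (auto simp: state_Suc final_state state_0 set_result)

lemma in_work_iff:
  assumes "e \<in> elems \<alpha>" "k \<le> length \<alpha>"
  shows "e \<in> set (work \<alpha> k) \<longleftrightarrow> push_time \<alpha> e < k \<and> k \<le> pop_time \<alpha> e"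
  using state_partition[OF assms(2)] push_time_less_iff[OF assms] pop_time_less_iff[OF assms] assms(1)
  by (auto simp: not_less[symmetric])

lemma times_less_length:
  assumes "e \<in> elems \<alpha>"
  shows "push_time \<alpha> e < length \<alpha>" "pop_time \<alpha> e < length \<alpha>"
  using assms push_time_less_iff[of e "length \<alpha>"] pop_time_less_iff[of e "length \<alpha>"]
  by (auto simp: final_state set_result)

lemma push_time_eq_iff:
  assumes "e \<in> elems \<alpha>" "k < length \<alpha>"
  shows "push_time \<alpha> e = k \<longleftrightarrow> is_push (\<alpha> ! k) \<and> e \<in> support \<alpha> k"
proof -
  have "push_time \<alpha> e = k \<longleftrightarrow> e \<in> set (inp \<alpha> k) \<and> e \<notin> set (inp \<alpha> (Suc k))"
    using push_time_less_iff[of e k] push_time_less_iff[of e "Suc k"] assms by auto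
  also have "\<dots> \<longleftrightarrow> is_push (\<alpha> ! k) \<and> e \<in> support \<alpha> k"
  proof (cases "is_push (\<alpha> ! k)")
    case True
    let ?b = "osize (\<alpha> ! k)"
    have "distinct (take ?b (inp \<alpha> k) @ drop ?b (inp \<alpha> k))"
      using state_partition[of k] assms by simp
    then have "set (take ?b (inp \<alpha> k)) \<inter> set (drop ?b (inp \<alpha> k)) = {}"
      unfolding distinct_append by blast
    moreover have "set (take ?b (inp \<alpha> k)) \<union> set (drop ?b (inp \<alpha> k)) = set (inp \<alpha> k)"
      by (metis append_take_drop_id set_append)
    ultimately show ?thesis using True assms by (auto simp: state_Suc support_eq)
  qed (use assms in \<open>auto simp: state_Suc\<close>)
  finally show ?thesis .
qed

lemma pop_time_eq_iff:
  assumes "e \<in> elems \<alpha>" "k < length \<alpha>"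
  shows "pop_time \<alpha> e = k \<longleftrightarrow> \<not> is_push (\<alpha> ! k) \<and> e \<in> support \<alpha> k"
proof -
  have "pop_time \<alpha> e = k \<longleftrightarrow> e \<notin> set (outp \<alpha> k) \<and> e \<in> set (outp \<alpha> (Suc k))"
    using pop_time_less_iff[of e k] pop_time_less_iff[of e "Suc k"] assms by auto
  also have "\<dots> \<longleftrightarrow> \<not> is_push (\<alpha> ! k) \<and> e \<in> support \<alpha> k"
  proof (cases "is_push (\<alpha> ! k)")
    case False
    have "set (work \<alpha> k) \<inter> set (outp \<alpha> k) = {}" using state_partition[of k] assms by auto
    then show ?thesis using False assms by (auto simp: state_Suc support_eq dest: in_set_takeD)
  qed (use assms in \<open>auto simp: state_Suc\<close>)
  finally show ?thesis .
qed

lemma is_push_push_time: "e \<in> elems \<alpha> \<Longrightarrow> is_push (\<alpha> ! push_time \<alpha> e)"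
  using push_time_eq_iff times_less_length by blast

lemma is_pop_pop_time: "e \<in> elems \<alpha> \<Longrightarrow> \<not> is_push (\<alpha> ! pop_time \<alpha> e)"
  using pop_time_eq_iff times_less_length by blast

lemma support_subset: "k < length \<alpha> \<Longrightarrow> support \<alpha> k \<subseteq> elems \<alpha>"
  using state_partition[of k] by (auto simp: support_eq dest: in_set_takeD)

lemma support_nonempty:
  assumes "k < length \<alpha>" shows "support \<alpha> k \<noteq> {}"
proof -
  have "Suc k \<le> length \<alpha>" using assms by simp
  from push_total_le[OF this] length_work_outp[OF this] length_work_outp[of k] osize_pos[OF assms] assms
  show ?thesis by (auto simp: support_eq totals_Suc inp_eq)
qed

text \<open>Blocks are nonempty; this is the source of \<open>no_idle\<close>.\<close>

lemma op_has_elem: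
  assumes "k < length \<alpha>"
  obtains e where "e \<in> elems \<alpha>" "is_push (\<alpha> ! k)" "push_time \<alpha> e = k"
  | e where "e \<in> elems \<alpha>" "\<not> is_push (\<alpha> ! k)" "pop_time \<alpha> e = k"
proof -
  obtain e where "e \<in> support \<alpha> k" "e \<in> elems \<alpha>"
    using support_nonempty support_subset assms by blast
  then show thesis using that push_time_eq_iff pop_time_eq_iff assms by blast
qed

lemma push_time_less_pop_time:
  assumes "e \<in> elems \<alpha>" shows "push_time \<alpha> e < pop_time \<alpha> e"
proof -
  have "e \<in> support \<alpha> (pop_time \<alpha> e)" "\<not> is_push (\<alpha> ! pop_time \<alpha> e)"
    using assms pop_time_eq_iff times_less_length by blast+
  then have "e \<in> set (work \<alpha> (pop_time \<alpha> e))" by (auto simp: support_eq dest: in_set_takeD)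
  then show ?thesis using in_work_iff[OF assms] times_less_length(2)[OF assms] by simp
qed

lemma push_time_mono:
  assumes "x \<in> elems \<alpha>" "y \<in> elems \<alpha>" "x < y"
  shows "push_time \<alpha> x \<le> push_time \<alpha> y"
proof -
  have l: "Suc (push_time \<alpha> y) \<le> length \<alpha>" using times_less_length assms by (simp add: Suc_le_eq)
  then have "y \<notin> set (inp \<alpha> (Suc (push_time \<alpha> y)))" using push_time_less_iff[OF assms(2) l] by simp
  then have "x \<notin> set (inp \<alpha> (Suc (push_time \<alpha> y)))" using l assms by (auto simp: inp_eq elems_def)
  then show ?thesis using push_time_less_iff[OF assms(1) l] by simp
qed

section \<open>Stack order and the schedule axioms\<close>

lemma sorted_work: "k \<le> length \<alpha> \<Longrightarrow> sorted_wrt (work_above \<alpha>) (work \<alpha> k)"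
proof (induction k)
  case 0 show ?case by (simp add: state_0)
next
  case (Suc k)
  then have k: "k < length \<alpha>" by simp
  have IH: "sorted_wrt (work_above \<alpha>) (work \<alpha> k)" using Suc by simp
  show ?case
  proof (cases "is_push (\<alpha> ! k)")
    case False
    then show ?thesis using IH k by (simp add: state_Suc sorted_wrt_drop)
  next
    case True
    let ?xs = "take (osize (\<alpha> ! k)) (inp \<alpha> k)"
    have xs: "push_time \<alpha> e = k" if "e \<in> set ?xs" for e
      using that True k push_time_eq_iff[of e k] support_subset[of k] by (auto simp: support_eq)
    have "sorted_wrt (<) ?xs" using k by (simp add: inp_eq sorted_wrt_take del: upt_Suc)
    then have "sorted_wrt (work_above \<alpha>) ?xs"
      by (rule sorted_wrt_mono_rel[rotated]) (auto simp: work_above_def xs)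
    moreover have "work_above \<alpha> a b" if "a \<in> set ?xs" "b \<in> set (work \<alpha> k)" for a b
      using xs[OF that(1)] in_work_iff[of b k] state_partition[of k] that k by (auto simp: work_above_def)
    ultimately show ?thesis using IH k True by (simp add: state_Suc sorted_wrt_append)
  qed
qed

lemma sorted_outp: "k \<le> length \<alpha> \<Longrightarrow> sorted_wrt (out_above \<alpha>) (outp \<alpha> k)"
proof (induction k)
  case 0 show ?case by (simp add: state_0)
next
  case (Suc k)
  then have k: "k < length \<alpha>" by simp
  have IH: "sorted_wrt (out_above \<alpha>) (outp \<alpha> k)" using Suc by simp
  show ?case
  proof (cases "is_push (\<alpha> ! k)")
    case True
    then show ?thesis using IH k by (simp add: state_Suc)
  next
    case False
    let ?xs = "take (osize (\<alpha> ! k)) (work \<alpha> k)"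
    have xs: "pop_time \<alpha> e = k" if "e \<in> set ?xs" for e
      using that False k pop_time_eq_iff[of e k] support_subset[of k] by (auto simp: support_eq)
    have "sorted_wrt (work_above \<alpha>) ?xs" using k by (simp add: sorted_work sorted_wrt_take)
    then have "sorted_wrt (out_above \<alpha>) ?xs"
      by (rule sorted_wrt_mono_rel[rotated]) (auto simp: out_above_def xs)
    moreover have "out_above \<alpha> a b" if "a \<in> set ?xs" "b \<in> set (outp \<alpha> k)" for a b
      using xs[OF that(1)] pop_time_less_iff[of b k] state_partition[of k] that k by (auto simp: out_above_def)
    ultimately show ?thesis using IH k False by (simp add: state_Suc sorted_wrt_append)
  qed
qed

text \<open>Last in, first out: were \<open>b\<close> popped first, \<open>a\<close> would then be
  on the stack but outside the popped top block, hence below \<open>b\<close>, against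
  \<open>above\<close>.\<close>

lemma pop_time_le_if_above:
  assumes a: "a \<in> elems \<alpha>" and b: "b \<in> elems \<alpha>"
    and above: "work_above \<alpha> a b" and coexist: "push_time \<alpha> a < pop_time \<alpha> b"
  shows "pop_time \<alpha> a \<le> pop_time \<alpha> b"
proof (rule ccontr)
  assume n: "\<not> pop_time \<alpha> a \<le> pop_time \<alpha> b"
  let ?k = "pop_time \<alpha> b"
  let ?n = "osize (\<alpha> ! ?k)"
  have k: "?k < length \<alpha>" using times_less_length b by simp
  have bs: "\<not> is_push (\<alpha> ! ?k)" "b \<in> set (take ?n (work \<alpha> ?k))"
    using pop_time_eq_iff[OF b k] by (auto simp: support_eq)
  have "a \<in> set (work \<alpha> ?k)" using in_work_iff[OF a] k coexist n by auto
  moreover have "a \<notin> set (take ?n (work \<alpha> ?k))"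
    using pop_time_eq_iff[OF a k] bs n by (auto simp: support_eq)
  ultimately have "a \<in> set (drop ?n (work \<alpha> ?k))"
    by (metis Un_iff append_take_drop_id set_append)
  moreover have "sorted_wrt (work_above \<alpha>) (take ?n (work \<alpha> ?k) @ drop ?n (work \<alpha> ?k))"
    using sorted_work[of ?k] k by simp
  ultimately have "work_above \<alpha> b a" using bs unfolding sorted_wrt_append by blast
  then show False using above by (auto simp: work_above_def)
qed

lemma out_pos:
  assumes "e \<in> elems \<alpha>"
  shows "out_pos \<alpha> e < length (result \<alpha>)" "result \<alpha> ! out_pos \<alpha> e = e"
proof -
  obtain i where i: "i < length (result \<alpha>)" "result \<alpha> ! i = e"
    using assms by (metis set_result in_set_conv_nth)
  from i(2) show "result \<alpha> ! out_pos \<alpha> e = e" unfolding out_pos_def by (rule LeastI)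
  \<comment> \<open>The \<open>LEAST\<close> in \<open>out_pos\<close> ranges over all naturals; the
    actual occurrence \<open>i\<close> keeps it inside the list.\<close>
  have "out_pos \<alpha> e \<le> i" using i(2) unfolding out_pos_def by (rule Least_le)
  then show "out_pos \<alpha> e < length (result \<alpha>)" using i by simp
qed

lemma out_above_if_out_pos_less:
  assumes "x \<in> elems \<alpha>" "y \<in> elems \<alpha>" "out_pos \<alpha> x < out_pos \<alpha> y"
  shows "out_above \<alpha> x y"
proof -
  have "sorted_wrt (out_above \<alpha>) (result \<alpha>)" using sorted_outp[of "length \<alpha>"] by (simp add: final_state)
  then show ?thesis
    using out_pos assms by (metis sorted_wrt_nth_less)
qed

text \<open>At a turn a reduced sequence pushes one element and pops one, which is the element just
  placed on top.\<close>

lemma turn_eq: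
  assumes red: "reduced \<alpha>" and x: "x \<in> elems \<alpha>" and y: "y \<in> elems \<alpha>"
    and eq: "pop_time \<alpha> y = Suc (push_time \<alpha> x)"
  shows "x = y"
proof -
  let ?i = "push_time \<alpha> x"
  have i: "Suc ?i < length \<alpha>" using times_less_length(2)[OF y] eq by simp
  have ops: "\<alpha> ! ?i = Push 1" "\<alpha> ! Suc ?i = Pop 1"
    using red i is_push_push_time[OF x] is_pop_pop_time[OF y] eq by (auto simp: reduced_def)
  have 1: "x \<in> support \<alpha> ?i" using push_time_eq_iff[of x ?i] x i by simp
  have 2: "y \<in> support \<alpha> (Suc ?i)" using pop_time_eq_iff[of y "Suc ?i"] y i eq by simp
  show ?thesis using 1 2 i ops by (cases "inp \<alpha> ?i") (auto simp: support_eq state_Suc)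
qed

text \<open>The input holds its elements in increasing order, so \<open>id\<close> serves as input
  position. The two pair conditions combine the output order, monotone push times and the
  last-in-first-out law.\<close>

lemma schedule_times:
  assumes red: "reduced \<alpha>"
  shows "schedule (elems \<alpha>) id (out_pos \<alpha>) (\<lambda>e. int (push_time \<alpha> e)) (\<lambda>e. int (pop_time \<alpha> e))"
proof
  show "inj_on id (elems \<alpha>)" by simp
  show "inj_on (out_pos \<alpha>) (elems \<alpha>)" by (rule inj_onI) (metis out_pos(2))
next
  fix x assume "x \<in> elems \<alpha>"
  then show "int (push_time \<alpha> x) < int (pop_time \<alpha> x)" using push_time_less_pop_time by simp
next
  fix x y assume x: "x \<in> elems \<alpha>" "y \<in> elems \<alpha>" "id x < id y" "out_pos \<alpha> x < out_pos \<alpha> y"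
  then show "int (push_time \<alpha> x) = int (push_time \<alpha> y) \<and> int (pop_time \<alpha> x) = int (pop_time \<alpha> y)
    \<or> int (push_time \<alpha> x) < int (push_time \<alpha> y) \<and> int (pop_time \<alpha> y) < int (pop_time \<alpha> x)"
    using out_above_if_out_pos_less[of x y] push_time_mono[of x y] pop_time_le_if_above[of x y]
      push_time_less_pop_time[of y]
    by (fastforce simp: out_above_def work_above_def)
next
  fix x y assume x: "x \<in> elems \<alpha>" "y \<in> elems \<alpha>" "id x < id y" "out_pos \<alpha> y < out_pos \<alpha> x"
  have "push_time \<alpha> y \<noteq> pop_time \<alpha> x"
    using is_push_push_time is_pop_pop_time x by metis
  then show "int (push_time \<alpha> x) = int (push_time \<alpha> y) \<and> int (pop_time \<alpha> x) < int (pop_time \<alpha> y)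
    \<or> int (push_time \<alpha> x) < int (push_time \<alpha> y) \<and> int (pop_time \<alpha> x) = int (pop_time \<alpha> y)
    \<or> int (pop_time \<alpha> x) < int (push_time \<alpha> y)"
    using out_above_if_out_pos_less[of y x] push_time_mono[of x y] pop_time_le_if_above[of y x] x
    by (fastforce simp: out_above_def work_above_def)
next
  fix x y assume x: "x \<in> elems \<alpha>" "y \<in> elems \<alpha>"
  then show "int (push_time \<alpha> x) \<noteq> int (pop_time \<alpha> y)"
    using is_push_push_time is_pop_pop_time by (metis of_nat_eq_iff)
next
  fix x k assume x: "x \<in> elems \<alpha>" "int (push_time \<alpha> x) \<le> k" "k \<le> int (pop_time \<alpha> x)"
  then obtain i where i: "k = int i" by (metis int_nat_eq nat_0_le of_nat_0_le_iff order_trans)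
  then have "i < length \<alpha>" using x times_less_length(2)[of x] by simp
  then show "k \<in> (\<lambda>e. int (push_time \<alpha> e)) ` elems \<alpha> \<union> (\<lambda>e. int (pop_time \<alpha> e)) ` elems \<alpha>"
    by (rule op_has_elem) (auto simp: i)
next
  fix x y assume "x \<in> elems \<alpha>" "y \<in> elems \<alpha>" "int (pop_time \<alpha> y) = int (push_time \<alpha> x) + 1"
  then show "x = y" using turn_eq[OF red, of x y] by linarith
qed

lemma corresponds_iff:
  "corresponds \<alpha> i j \<longleftrightarrow> (\<exists>e\<in>elems \<alpha>.
    push_time \<alpha> e = i \<and> pop_time \<alpha> e = j \<or> pop_time \<alpha> e = i \<and> push_time \<alpha> e = j)"
proof
  assume c: "corresponds \<alpha> i j"
  then obtain e where "e \<in> support \<alpha> i" "e \<in> support \<alpha> j" by (auto simp: corresponds_def)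
  moreover have "e \<in> elems \<alpha>" using calculation c support_subset by (auto simp: corresponds_def)
  ultimately show "\<exists>e\<in>elems \<alpha>.
    push_time \<alpha> e = i \<and> pop_time \<alpha> e = j \<or> pop_time \<alpha> e = i \<and> push_time \<alpha> e = j"
    using c push_time_eq_iff[of e] pop_time_eq_iff[of e] unfolding corresponds_def by metis
next
  assume "\<exists>e\<in>elems \<alpha>.
    push_time \<alpha> e = i \<and> pop_time \<alpha> e = j \<or> pop_time \<alpha> e = i \<and> push_time \<alpha> e = j"
  then obtain e where "e \<in> elems \<alpha>"
    "push_time \<alpha> e = i \<and> pop_time \<alpha> e = j \<or> pop_time \<alpha> e = i \<and> push_time \<alpha> e = j" by blast
  then show "corresponds \<alpha> i j"
    using times_less_length[of e] push_time_eq_iff[of e "push_time \<alpha> e"]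
      pop_time_eq_iff[of e "pop_time \<alpha> e"]
    by (auto simp: corresponds_def)
qed

section \<open>Vertices and the sets of pushed and popped elements\<close>

lemma push_time_less_iff_total:
  assumes "e \<in> elems \<alpha>" "k \<le> length \<alpha>"
  shows "push_time \<alpha> e < k \<longleftrightarrow> e \<le> push_total (take k \<alpha>)"
  using push_time_less_iff[OF assms] assms by (auto simp: inp_eq elems_def)

lemma pop_time_less_iff_total:
  assumes "e \<in> elems \<alpha>" "k \<le> length \<alpha>"
  shows "pop_time \<alpha> e < k \<longleftrightarrow> e \<in> set (drop (seq_size \<alpha> - pop_total (take k \<alpha>)) (result \<alpha>))"
  using pop_time_less_iff[OF assms] assms by (auto simp: outp_eq)

lemma push_total_eq_card:
  assumes "k \<le> length \<alpha>"
  shows "push_total (take k \<alpha>) = card {e \<in> elems \<alpha>. push_time \<alpha> e < k}"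
proof -
  have "{e \<in> elems \<alpha>. push_time \<alpha> e < k} = {1..push_total (take k \<alpha>)}"
    using push_time_less_iff_total[OF _ assms] push_total_le[OF assms] by (auto simp: elems_def)
  then show ?thesis by simp
qed

lemma pop_total_eq_card:
  assumes "k \<le> length \<alpha>"
  shows "pop_total (take k \<alpha>) = card {e \<in> elems \<alpha>. pop_time \<alpha> e < k}"
proof -
  have "{e \<in> elems \<alpha>. pop_time \<alpha> e < k} = set (outp \<alpha> k)"
    using pop_time_less_iff[OF _ assms] state_partition[OF assms] by auto
  moreover have "card (set (outp \<alpha> k)) = length (outp \<alpha> k)"
    using state_partition[OF assms] by (auto intro: distinct_card)
  ultimately show ?thesis using length_work_outp[OF assms] by simp
qed

end

lemma vertex_eq_iff:
  "vertex \<beta> j = vertex \<alpha> i \<longleftrightarrow>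
    push_total (take j \<beta>) = push_total (take i \<alpha>) \<and> pop_total (take j \<beta>) = pop_total (take i \<alpha>)"
  by (auto simp: vertex_def)

text \<open>The totals determine the pushed elements, an initial segment of the input, and the
  popped ones, a suffix of the common result; conversely they are the sizes of these sets.\<close>

lemma vertex_eq_iff_times:
  assumes "equivalent \<alpha> \<beta>" "i \<le> length \<alpha>" "j \<le> length \<beta>"
  shows "vertex \<beta> j = vertex \<alpha> i \<longleftrightarrow> (\<forall>e\<in>elems \<alpha>.
    (push_time \<alpha> e < i \<longleftrightarrow> push_time \<beta> e < j) \<and> (pop_time \<alpha> e < i \<longleftrightarrow> pop_time \<beta> e < j))"
proof -
  have wf: "well_formed \<alpha>" "well_formed \<beta>" and el: "elems \<beta> = elems \<alpha>"
    and eq: "seq_size \<beta> = seq_size \<alpha>" "result \<beta> = result \<alpha>"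
    using assms by (auto simp: equivalent_def elems_def)
  show ?thesis
  proof
    assume "vertex \<beta> j = vertex \<alpha> i"
    then show "\<forall>e\<in>elems \<alpha>. (push_time \<alpha> e < i \<longleftrightarrow> push_time \<beta> e < j) \<and>
      (pop_time \<alpha> e < i \<longleftrightarrow> pop_time \<beta> e < j)"
      using assms wf by (auto simp: vertex_eq_iff push_time_less_iff_total pop_time_less_iff_total el eq)
  next
    assume *: "\<forall>e\<in>elems \<alpha>. (push_time \<alpha> e < i \<longleftrightarrow> push_time \<beta> e < j) \<and>
      (pop_time \<alpha> e < i \<longleftrightarrow> pop_time \<beta> e < j)"
    have "{e \<in> elems \<alpha>. push_time \<alpha> e < i} = {e \<in> elems \<alpha>. push_time \<beta> e < j}"
      "{e \<in> elems \<alpha>. pop_time \<alpha> e < i} = {e \<in> elems \<alpha>. pop_time \<beta> e < j}"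
      using * by blast+
    then show "vertex \<beta> j = vertex \<alpha> i"
      using assms wf by (simp add: vertex_eq_iff push_total_eq_card pop_total_eq_card el)
  qed
qed

text \<open>The condition that \<open>fixed_op\<close> imposes for a single \<beta>.\<close>

definition same_edge :: "oper list \<Rightarrow> oper list \<Rightarrow> nat \<Rightarrow> bool" where
  "same_edge \<alpha> \<beta> i \<longleftrightarrow>
    (\<exists>j < length \<beta>. vertex \<beta> j = vertex \<alpha> i \<and> vertex \<beta> (Suc j) = vertex \<alpha> (Suc i))"

section \<open>Shared edges of two equivalent reduced sequences\<close>

locale equivalent_reduced =
  fixes \<alpha> \<beta> :: "oper list"
  assumes reduced: "reduced \<alpha>" "reduced \<beta>" and equiv: "equivalent \<alpha> \<beta>"
begin

lemma wf: "well_formed \<alpha>" "well_formed \<beta>"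
  using equiv by (auto simp: equivalent_def)

lemma elems_eq: "elems \<beta> = elems \<alpha>"
  using equiv by (auto simp: equivalent_def elems_def)

lemma out_pos_eq: "out_pos \<beta> = out_pos \<alpha>"
  using equiv by (auto simp: equivalent_def out_pos_def)

sublocale P: schedule_pair "elems \<alpha>" id "out_pos \<alpha>"
  "\<lambda>e. int (push_time \<alpha> e)" "\<lambda>e. int (pop_time \<alpha> e)"
  "\<lambda>e. int (push_time \<beta> e)" "\<lambda>e. int (pop_time \<beta> e)"
  using schedule_times[OF wf(1) reduced(1)] schedule_times[OF wf(2) reduced(2)]
  by (simp add: schedule_pair.intro elems_eq out_pos_eq)

text \<open>The pushes of \<open>D\<close> are the pops of the sequences with time running
  backwards, so results on push blocks apply to pop blocks.\<close>

sublocale D: schedule_pair "elems \<alpha>" "out_pos \<alpha>" id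
  "\<lambda>e. - int (pop_time \<alpha> e)" "\<lambda>e. - int (push_time \<alpha> e)"
  "\<lambda>e. - int (pop_time \<beta> e)" "\<lambda>e. - int (push_time \<beta> e)"
  by (rule P.dual_pair)

text \<open>A shared edge determines the block: the elements pushed by its end vertex but not by its
  start. Conversely, a shared block starts at a common vertex by
  \<open>same_vertex_of_same_push_block\<close>, and adding the block gives the common end.\<close>

lemma same_edge_push_iff:
  assumes x: "x \<in> elems \<alpha>"
  shows "same_edge \<alpha> \<beta> (push_time \<alpha> x) \<longleftrightarrow>
    (\<forall>e\<in>elems \<alpha>. push_time \<alpha> e = push_time \<alpha> x \<longleftrightarrow> push_time \<beta> e = push_time \<beta> x)"
    (is "_ \<longleftrightarrow> ?block")
proof
  let ?i = "push_time \<alpha> x"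
  have i: "?i < length \<alpha>" using times_less_length[OF wf(1) x] by simp
  {
    assume "same_edge \<alpha> \<beta> ?i"
    then obtain j where j: "j < length \<beta>" "vertex \<beta> j = vertex \<alpha> ?i"
      "vertex \<beta> (Suc j) = vertex \<alpha> (Suc ?i)" by (auto simp: same_edge_def)
    then have *: "push_time \<alpha> e = ?i \<longleftrightarrow> push_time \<beta> e = j" if "e \<in> elems \<alpha>" for e
      using vertex_eq_iff_times[OF equiv, of ?i j] vertex_eq_iff_times[OF equiv, of "Suc ?i" "Suc j"] i that
      by (metis Suc_leI less_antisym less_imp_le_nat less_not_refl lessI)
    then show ?block using x by metis
  next
    assume blk: ?block
    let ?j = "push_time \<beta> x"
    have j: "?j < length \<beta>" using times_less_length[OF wf(2)] x elems_eq by simp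
    have v: "\<forall>e\<in>elems \<alpha>. (push_time \<alpha> e < ?i \<longleftrightarrow> push_time \<beta> e < ?j) \<and>
      (pop_time \<alpha> e < ?i \<longleftrightarrow> pop_time \<beta> e < ?j)"
      using P.same_vertex_of_same_push_block[OF x] blk by simp
    \<comment> \<open>A push position pops nothing, so the popped elements are the same at both ends
      of the edge.\<close>
    have ne: "pop_time \<alpha> e \<noteq> ?i" "pop_time \<beta> e \<noteq> ?j" if "e \<in> elems \<alpha>" for e
      using P.A.push_neq_pop[OF x that] P.B.push_neq_pop[OF x that] by auto
    have "vertex \<beta> ?j = vertex \<alpha> ?i"
      using v i j by (subst vertex_eq_iff_times[OF equiv]) auto
    moreover have "vertex \<beta> (Suc ?j) = vertex \<alpha> (Suc ?i)"
      using v blk ne i j by (subst vertex_eq_iff_times[OF equiv]) (auto simp: less_Suc_eq)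
    ultimately show "same_edge \<alpha> \<beta> ?i" using j by (auto simp: same_edge_def)
  }
qed

lemma same_edge_pop_iff:
  assumes x: "x \<in> elems \<alpha>"
  shows "same_edge \<alpha> \<beta> (pop_time \<alpha> x) \<longleftrightarrow>
    (\<forall>e\<in>elems \<alpha>. pop_time \<alpha> e = pop_time \<alpha> x \<longleftrightarrow> pop_time \<beta> e = pop_time \<beta> x)"
    (is "_ \<longleftrightarrow> ?block")
proof
  let ?i = "pop_time \<alpha> x"
  have i: "?i < length \<alpha>" using times_less_length[OF wf(1) x] by simp
  {
    assume "same_edge \<alpha> \<beta> ?i"
    then obtain j where j: "j < length \<beta>" "vertex \<beta> j = vertex \<alpha> ?i"
      "vertex \<beta> (Suc j) = vertex \<alpha> (Suc ?i)" by (auto simp: same_edge_def)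
    then have *: "pop_time \<alpha> e = ?i \<longleftrightarrow> pop_time \<beta> e = j" if "e \<in> elems \<alpha>" for e
      using vertex_eq_iff_times[OF equiv, of ?i j] vertex_eq_iff_times[OF equiv, of "Suc ?i" "Suc j"] i that
      by (metis Suc_leI less_antisym less_imp_le_nat less_not_refl lessI)
    then show ?block using x by metis
  next
    assume blk: ?block
    let ?j = "pop_time \<beta> x"
    have j: "?j < length \<beta>" using times_less_length[OF wf(2)] x elems_eq by simp
    \<comment> \<open>In reversed time the vertex theorem speaks of what happens after the pop. So
      the end vertex comes directly, and the start vertex by putting the block back.\<close>
    have v: "(?i < pop_time \<alpha> e \<longleftrightarrow> ?j < pop_time \<beta> e) \<and>
      (?i < push_time \<alpha> e \<longleftrightarrow> ?j < push_time \<beta> e)" if "e \<in> elems \<alpha>" for e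
      using D.same_vertex_of_same_push_block[OF x] blk that by simp
    have ne: "push_time \<alpha> e \<noteq> ?i" "push_time \<beta> e \<noteq> ?j" if "e \<in> elems \<alpha>" for e
      using P.A.push_neq_pop[OF that x] P.B.push_neq_pop[OF that x] by auto
    have "\<forall>e\<in>elems \<alpha>. (push_time \<alpha> e < ?i \<longleftrightarrow> push_time \<beta> e < ?j) \<and>
      (pop_time \<alpha> e < ?i \<longleftrightarrow> pop_time \<beta> e < ?j)"
      using v ne blk by (metis linorder_neqE_nat less_asym)
    then have "vertex \<beta> ?j = vertex \<alpha> ?i"
      using i j by (subst vertex_eq_iff_times[OF equiv]) auto
    moreover have "vertex \<beta> (Suc ?j) = vertex \<alpha> (Suc ?i)"
      using v i j by (subst vertex_eq_iff_times[OF equiv]) (auto simp: less_Suc_eq_le not_less[symmetric])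
    ultimately show "same_edge \<alpha> \<beta> ?i" using j by (auto simp: same_edge_def)
  }
qed

text \<open>One block theorem serves both directions: \<open>P\<close> passes from a shared pop
  block to the push blocks it meets, \<open>D\<close> from a shared push block to the pop
  blocks.\<close>

lemma same_edge_corresponds:
  assumes "corresponds \<alpha> i j" "same_edge \<alpha> \<beta> j"
  shows "same_edge \<alpha> \<beta> i"
proof -
  obtain e where e: "e \<in> elems \<alpha>"
    "push_time \<alpha> e = i \<and> pop_time \<alpha> e = j \<or> pop_time \<alpha> e = i \<and> push_time \<alpha> e = j"
    using assms corresponds_iff[OF wf(1)] by blast
  from e(2) show ?thesis
  proof
    assume "push_time \<alpha> e = i \<and> pop_time \<alpha> e = j"
    then show ?thesis
      using assms(2) P.same_push_block_of_same_pop_block[OF e(1)]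
        same_edge_push_iff[OF e(1)] same_edge_pop_iff[OF e(1)]
      unfolding of_nat_eq_iff by blast
  next
    assume "pop_time \<alpha> e = i \<and> push_time \<alpha> e = j"
    then show ?thesis
      using assms(2) D.same_push_block_of_same_pop_block[OF e(1)]
        same_edge_push_iff[OF e(1)] same_edge_pop_iff[OF e(1)]
      unfolding neg_equal_iff_equal of_nat_eq_iff by blast
  qed
qed

lemma same_edge_if_not_consecutive:
  assumes i: "i < length \<alpha>" and nc: "\<not> consecutive {j. corresponds \<alpha> i j}"
  shows "same_edge \<alpha> \<beta> i"
proof -
  obtain j k m where c: "corresponds \<alpha> i j" "corresponds \<alpha> i k" "\<not> corresponds \<alpha> i m"
    and le: "j \<le> m" "m \<le> k"
    using nc unfolding consecutive_def mem_Collect_eq by metis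
  then have l: "j < m" "m < k" by (auto simp: le_less)
  note cor = corresponds_iff[OF wf(1)]
  note push = is_push_push_time[OF wf(1)] and pop = is_pop_pop_time[OF wf(1)]
  from op_has_elem[OF wf(1) i] show ?thesis
  proof cases
    case 1
    then have "pop_time \<alpha> e \<noteq> i" if "e \<in> elems \<alpha>" for e using pop that by metis
    then obtain x y where x: "x \<in> elems \<alpha>" "push_time \<alpha> x = i" "pop_time \<alpha> x = j"
      and y: "y \<in> elems \<alpha>" "push_time \<alpha> y = i" "pop_time \<alpha> y = k"
      using c cor by metis
    have "\<forall>e\<in>elems \<alpha>. push_time \<alpha> e = i \<longrightarrow> pop_time \<alpha> e \<noteq> m" using c cor by metis
    then have "\<forall>e\<in>elems \<alpha>. int (push_time \<alpha> e) = int (push_time \<alpha> x) \<longleftrightarrow>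
        int (push_time \<beta> e) = int (push_time \<beta> x)"
      using x y l by (intro P.same_push_block_of_gap[OF x(1) y(1), of "int m"]) auto
    then show ?thesis using same_edge_push_iff[OF x(1)] x(2) by simp
  next
    case 2
    then have "push_time \<alpha> e \<noteq> i" if "e \<in> elems \<alpha>" for e using push that by metis
    \<comment> \<open>Reversal flips the order: the element pushed at the later position
      \<open>k\<close> takes the role of \<open>x\<close>, and the gap sits at
      \<open>- int m\<close>.\<close>
    then obtain x y where x: "x \<in> elems \<alpha>" "pop_time \<alpha> x = i" "push_time \<alpha> x = k"
      and y: "y \<in> elems \<alpha>" "pop_time \<alpha> y = i" "push_time \<alpha> y = j"
      using c cor by metis
    have "\<forall>e\<in>elems \<alpha>. pop_time \<alpha> e = i \<longrightarrow> push_time \<alpha> e \<noteq> m" using c cor by metis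
    then have "\<forall>e\<in>elems \<alpha>. - int (pop_time \<alpha> e) = - int (pop_time \<alpha> x) \<longleftrightarrow>
        - int (pop_time \<beta> e) = - int (pop_time \<beta> x)"
      using x y l by (intro D.same_push_block_of_gap[OF x(1) y(1), of "- int m"]) auto
    then show ?thesis using same_edge_pop_iff[OF x(1)] x(2) by simp
  qed
qed

end

section \<open>From shared edges to fixed operations\<close>

lemma fixed_op_iff:
  assumes "reduced \<alpha>"
  shows "fixed_op \<alpha> i \<longleftrightarrow>
    i < length \<alpha> \<and> (\<forall>\<beta>. equivalent_reduced \<alpha> \<beta> \<longrightarrow> same_edge \<alpha> \<beta> i)"
  using assms by (simp add: fixed_op_def equivalent_reduced_def same_edge_def)

theorem mainTheorem12:
  assumes "well_formed \<alpha>" and "reduced \<alpha>"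
  shows "(\<forall>i < length \<alpha>. \<not> consecutive {j. corresponds \<alpha> i j} \<longrightarrow> fixed_op \<alpha> i)
       \<and> (\<forall>i j. corresponds \<alpha> i j \<and> fixed_op \<alpha> j \<longrightarrow> fixed_op \<alpha> i)"
proof (intro conjI allI impI)
  fix i assume "i < length \<alpha>" "\<not> consecutive {j. corresponds \<alpha> i j}"
  then show "fixed_op \<alpha> i"
    by (simp add: fixed_op_iff[OF assms(2)] equivalent_reduced.same_edge_if_not_consecutive)
next
  fix i j assume c: "corresponds \<alpha> i j \<and> fixed_op \<alpha> j"
  then have "i < length \<alpha>" by (simp add: corresponds_def)
  then show "fixed_op \<alpha> i"
    using c equivalent_reduced.same_edge_corresponds unfolding fixed_op_iff[OF assms(2)] by metis
qed

end
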